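(* For every integer $R\ge 1$, $$ t(r+R,r)\le (\mu+o(1))\,\binom{r+R}{R}^{-1}\quad\text{as } r\to\infty,$$ where $\mu:=(c_0+1)^{R+1}/c_0^{R}$ and $c_0=c_0(R)$ is the largest real root of the equation $\mathrm{e}^{c}=(c+1)^{R+1}$.
   Context: An $r$-graph on a vertex set $V$ is a collection of $r$-subsets of $V$. For positive integers $n\ge s>r$, a Turán $(n,s,r)$-system is an $r$-graph $G$ on an $n$-element set $V$ such that every $s$-subset of $V$ contains at least one edge of $G$; $T(n,s,r)$ denotes the minimum number of edges of such a system. The Turán density is $t(s,r):=\lim_{n\to\infty} T(n,s,r)/\binom{n}{r}$ (this limit exists). *)

theory Defs
  imports "HOL-Analysis.Analysis" "HOL-Library.Ramsey" "HOL-Library.Landau_Symbols"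
begin

text \<open>An \<open>r\<close>-graph is identified with its set of edges; \<^term>\<open>nsets V r\<close> is the set of
  \<open>r\<close>-element subsets of \<open>V\<close>.\<close>

definition r_graph :: "nat \<Rightarrow> 'a set \<Rightarrow> 'a set set \<Rightarrow> bool" where
  "r_graph r V G \<longleftrightarrow> G \<subseteq> nsets V r"

definition turan_system :: "'a set \<Rightarrow> nat \<Rightarrow> nat \<Rightarrow> 'a set set \<Rightarrow> bool" where
  "turan_system V s r G \<longleftrightarrow> r_graph r V G \<and> (\<forall>S \<in> nsets V s. \<exists>e \<in> G. e \<subseteq> S)"

text \<open>The minimum depends only on the size of the vertex set, so the vertex set is fixed to be
  \<^term>\<open>{..<n}\<close>. The intended range is \<open>n \<ge> s > r \<ge> 1\<close>; for \<open>n < s\<close> the value is \<open>0\<close>, which does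
  not affect the limit below.\<close>

definition turan_number :: "nat \<Rightarrow> nat \<Rightarrow> nat \<Rightarrow> nat" where
  "turan_number n s r = (LEAST m. \<exists>G. turan_system {..<n} s r G \<and> card G = m)"

definition turan_density :: "nat \<Rightarrow> nat \<Rightarrow> real" where
  "turan_density s r = lim (\<lambda>n. real (turan_number n s r) / real (n choose r))"

text \<open>For \<open>R \<ge> 1\<close> the equation has finitely many real roots, among them \<open>0\<close> and a positive one,
  so the largest root exists and is positive.\<close>

definition c0 :: "nat \<Rightarrow> real" where
  "c0 R = (GREATEST c::real. exp c = (c + 1) ^ (R + 1))"

definition mu :: "nat \<Rightarrow> real" where
  "mu R = (c0 R + 1) ^ (R + 1) / c0 R ^ R"

end

theory Submission
  imports Defs
begin

text \<open>Order the vertices linearly and write \<open>r = k + R + m\<close>. Choose a random family \<open>W\<close> of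
  \<open>k\<close>-sets, each with probability \<open>p\<close>, and let \<open>G\<close> be a randomly permuted optimal
  \<open>(n, m + R, m)\<close>-system. Take the \<open>r\<close>-sets whose first \<open>k\<close> elements form a member of \<open>W\<close>, and
  those whose first \<open>k + R\<close> elements contain no member of \<open>W\<close> while the last \<open>m\<close> form an edge
  of \<open>G\<close>. This is an \<open>(n, r + R, r)\<close>-system: the first \<open>k + R\<close> elements of an \<open>(r + R)\<close>-set
  either contain some \<open>K \<in> W\<close>, which together with the last \<open>m + R\<close> elements is an edge, or they
  form an edge with an \<open>m\<close>-subset of the last \<open>m + R\<close> elements. Averaging gives
  \<open>t(r + R, r) \<le> p + (1 - p)^N t(m + R, m)\<close> with \<open>N = (k + R) choose R\<close>. With \<open>p = c / N\<close>,
  \<open>k\<close> about \<open>r c / (c + 1)\<close> and \<open>c = c\<^sub>0\<close>, the numbers \<open>a(r) = t(r + R, r) ((r + R) choose R)\<close>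
  satisfy \<open>a(r) \<le> (c + 1)^R / c^(R - 1) + o(1) + (1 / (c + 1) + o(1)) a(m)\<close>, a contraction whose
  fixed point is \<open>\<mu>\<close>.\<close>

section \<open>Turan numbers and the existence of the Turan density\<close>

text \<open>Relabelling along a bijection with \<open>{..<card V}\<close> preserves the covering
  property, so systems on arbitrary finite vertex sets bound \<open>turan_number\<close>.\<close>

lemma turan_number_le_card:
  assumes "finite V" "turan_system V s r G"
  shows "turan_number (card V) s r \<le> card G"
proof -
  obtain h where h: "bij_betw h V {..<card V}"
    using ex_bij_betw_finite_nat[OF assms(1)] by (auto simp: lessThan_atLeast0)
  have G: "G \<subseteq> nsets V r" and cov: "\<And>S. S \<in> nsets V s \<Longrightarrow> \<exists>e\<in>G. e \<subseteq> S"
    using assms(2) by (auto simp: turan_system_def r_graph_def)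
  have finG: "finite G"
    using finite_subset[OF G] finite_imp_finite_nsets[OF assms(1)] by blast
  have inj: "inj_on h V" and im: "h ` V = {..<card V}"
    using h by (auto simp: bij_betw_def)
  have "turan_system {..<card V} s r ((`) h ` G)"
    unfolding turan_system_def r_graph_def
  proof (intro conjI ballI)
    show "(`) h ` G \<subseteq> nsets {..<card V} r"
    proof (intro image_subsetI)
      fix e assume "e \<in> G"
      then have e: "e \<subseteq> V" "finite e" "card e = r" using G by (auto simp: nsets_def)
      then show "h ` e \<in> nsets {..<card V} r"
        using im inj by (auto simp: nsets_def card_image inj_on_subset)
    qed
  next
    fix S assume S: "S \<in> nsets {..<card V} s"
    let ?S = "inv_into V h ` S"
    have Sim: "S \<subseteq> h ` V" using S im by (auto simp: nsets_def)
    have "card ?S = card S"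
      using Sim by (intro card_image inj_on_inv_into)
    then have "?S \<in> nsets V s"
      using S Sim by (auto simp: nsets_def inv_into_into)
    then obtain e where e: "e \<in> G" "e \<subseteq> ?S" using cov by blast
    have "h ` e \<subseteq> h ` ?S" using e(2) by blast
    also have "\<dots> = S" using Sim by (rule image_inv_into_cancel[OF refl])
    finally show "\<exists>e\<in>(`) h ` G. e \<subseteq> S" using e(1) by blast
  qed
  then have "turan_number (card V) s r \<le> card ((`) h ` G)"
    unfolding turan_number_def by (intro Least_le) blast
  also have "\<dots> \<le> card G" using finG by (rule card_image_le)
  finally show ?thesis .
qed

lemma turan_system_nsets:
  assumes "r \<le> s"
  shows "turan_system V s r (nsets V r)"
  unfolding turan_system_def r_graph_def
proof (intro conjI ballI)
  fix S assume S: "S \<in> nsets V s"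
  then obtain e where "e \<subseteq> S" "card e = r" "finite e"
    using obtain_subset_with_card_n[of r S] assms by (auto simp: nsets_def)
  then show "\<exists>e\<in>nsets V r. e \<subseteq> S" using S by (auto simp: nsets_def)
qed simp

lemma card_nsets:
  assumes "finite V"
  shows "card (nsets V r) = card V choose r"
proof -
  have "nsets V r = {N. N \<subseteq> V \<and> card N = r}"
    using finite_subset[OF _ assms] by (auto simp: nsets_def)
  then show ?thesis using n_subsets[OF assms] by simp
qed

lemma optimal_turan_system:
  assumes "r \<le> s"
  obtains G where "turan_system {..<n} s r G" "card G = turan_number n s r"
proof -
  have "\<exists>m G. turan_system {..<n} s r G \<and> card G = m"
    using turan_system_nsets[OF assms] by blast
  from LeastI_ex[OF this] show ?thesis
    using that unfolding turan_number_def by blast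
qed

lemma turan_number_le_choose:
  assumes "r \<le> s"
  shows "turan_number n s r \<le> n choose r"
  using turan_number_le_card[OF _ turan_system_nsets[OF assms], of "{..<n}"]
  by (simp add: card_nsets)

lemma sum_card_Collect_swap:
  assumes "finite A" "finite B"
  shows "(\<Sum>x\<in>A. card {y\<in>B. P x y}) = (\<Sum>y\<in>B. card {x\<in>A. P x y})"
proof -
  have "card {y\<in>B. P x y} = (\<Sum>y\<in>B. if P x y then 1 else 0)" for x
    using assms by (simp add: sum.If_cases Int_def)
  moreover have "card {x\<in>A. P x y} = (\<Sum>x\<in>A. if P x y then 1 else 0)" for y
    using assms by (simp add: sum.If_cases Int_def)
  ultimately show ?thesis by (simp only: sum.swap[of _ B A])
qed

text \<open>Deleting a vertex \<open>v\<close> from an optimal system leaves the edges avoiding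
  \<open>v\<close>, again a system, on \<open>n\<close> vertices. Summed over all \<open>v\<close>,
  each edge survives exactly \<open>Suc n - r\<close> deletions.\<close>

lemma turan_number_averaging:
  assumes "r \<le> s"
  shows "Suc n * turan_number n s r \<le> (Suc n - r) * turan_number (Suc n) s r"
proof -
  obtain G where G: "turan_system {..<Suc n} s r G" "card G = turan_number (Suc n) s r"
    using optimal_turan_system[OF assms] .
  have Gr: "G \<subseteq> nsets {..<Suc n} r"
    using G(1) by (auto simp: turan_system_def r_graph_def)
  have finG: "finite G"
    using finite_subset[OF Gr] finite_imp_finite_nsets by blast
  have le: "turan_number n s r \<le> card {e\<in>G. v \<notin> e}" if v: "v \<in> {..<Suc n}" for v
  proof -
    have "turan_system ({..<Suc n} - {v}) s r {e\<in>G. v \<notin> e}"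
      unfolding turan_system_def r_graph_def
    proof (intro conjI ballI)
      show "{e\<in>G. v \<notin> e} \<subseteq> nsets ({..<Suc n} - {v}) r"
        using Gr by (auto simp: nsets_def)
    next
      fix S assume "S \<in> nsets ({..<Suc n} - {v}) s"
      then have "S \<in> nsets {..<Suc n} s" "v \<notin> S" by (auto simp: nsets_def)
      then show "\<exists>e\<in>{e\<in>G. v \<notin> e}. e \<subseteq> S"
        using G(1) unfolding turan_system_def by blast
    qed
    then have "turan_number (card ({..<Suc n} - {v})) s r \<le> card {e\<in>G. v \<notin> e}"
      by (intro turan_number_le_card) auto
    then show ?thesis using v by simp
  qed
  have "Suc n * turan_number n s r = (\<Sum>v\<in>{..<Suc n}. turan_number n s r)" by simp
  also have "\<dots> \<le> (\<Sum>v\<in>{..<Suc n}. card {e\<in>G. v \<notin> e})"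
    using le by (rule sum_mono)
  also have "\<dots> = (\<Sum>e\<in>G. card {v\<in>{..<Suc n}. v \<notin> e})"
    using finG by (intro sum_card_Collect_swap) auto
  also have "\<dots> = (\<Sum>e\<in>G. Suc n - r)"
  proof (rule sum.cong[OF refl])
    fix e assume "e \<in> G"
    then have e: "e \<subseteq> {..<Suc n}" "finite e" "card e = r" using Gr by (auto simp: nsets_def)
    have "{v\<in>{..<Suc n}. v \<notin> e} = {..<Suc n} - e" by blast
    then show "card {v\<in>{..<Suc n}. v \<notin> e} = Suc n - r"
      using e by (simp add: card_Diff_subset del: lessThan_Suc)
  qed
  finally show ?thesis using G(2) by (simp add: mult.commute)
qed

section \<open>Monotone convergence of the edge ratios\<close>

definition turan_ratio :: "nat \<Rightarrow> nat \<Rightarrow> nat \<Rightarrow> real" where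
  "turan_ratio s r n = real (turan_number n s r) / real (n choose r)"

lemma turan_ratio_nonneg: "0 \<le> turan_ratio s r n"
  by (simp add: turan_ratio_def)

lemma turan_ratio_le_1:
  assumes "r \<le> s"
  shows "turan_ratio s r n \<le> 1"
  using turan_number_le_choose[OF assms, of n]
  by (cases "n choose r = 0") (auto simp: turan_ratio_def divide_simps)

lemma turan_ratio_Suc:
  assumes "r \<le> s"
  shows "turan_ratio s r n \<le> turan_ratio s r (Suc n)"
proof (cases "r \<le> n")
  case False
  \<comment> \<open>Here the denominator \<open>n choose r\<close> is 0, and division by zero gives
    0.\<close>
  then have "turan_ratio s r n = 0" by (simp add: turan_ratio_def binomial_eq_0)
  then show ?thesis using turan_ratio_nonneg[of s r "Suc n"] by simp
next
  case True
  have C: "Suc n * (n choose r) = (Suc n - r) * (Suc n choose r)"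
    using binomial_absorb_comp[of "Suc n" r] by simp
  have pos: "real (n choose r) > 0" "real (Suc n choose r) > 0" "real (Suc n) > 0"
    "real (Suc n - r) > 0" using True by auto
  have "real (Suc n) * real (turan_number n s r) \<le> real (Suc n - r) * real (turan_number (Suc n) s r)"
    using turan_number_averaging[OF assms, of n] by (metis of_nat_mono of_nat_mult)
  then have "(real (Suc n) * real (turan_number n s r)) / (real (Suc n) * real (n choose r))
     \<le> (real (Suc n - r) * real (turan_number (Suc n) s r)) / (real (Suc n) * real (n choose r))"
    by (intro divide_right_mono) auto
  moreover have "real (Suc n) * real (n choose r) = real (Suc n - r) * real (Suc n choose r)"
    using C by (metis of_nat_mult)
  ultimately show ?thesis
    using pos unfolding turan_ratio_def
    by (metis mult_divide_mult_cancel_left less_irrefl)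
qed

text \<open>The ratios increase and are bounded by 1, so the \<open>lim\<close> in
  \<open>turan_density\<close> is a genuine limit.\<close>

lemma turan_ratio_tendsto:
  assumes "r \<le> s"
  shows "turan_ratio s r \<longlonglongrightarrow> turan_density s r"
proof -
  have "incseq (turan_ratio s r)"
    using turan_ratio_Suc[OF assms] by (rule incseq_SucI)
  then obtain L where "turan_ratio s r \<longlonglongrightarrow> L"
    using incseq_convergent[of "turan_ratio s r" 1] turan_ratio_le_1[OF assms] by blast
  then have "convergent (turan_ratio s r)" by (rule convergentI)
  then show ?thesis
    by (simp add: turan_density_def convergent_LIMSEQ_iff turan_ratio_def[abs_def])
qed

lemma turan_density_nonneg:
  assumes "r \<le> s"
  shows "0 \<le> turan_density s r"
  using turan_ratio_tendsto[OF assms] by (rule LIMSEQ_le_const) (use turan_ratio_nonneg in blast)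

section \<open>Averaging over permutations and over random families\<close>

lemma permutes_image_nsets:
  assumes "\<sigma> permutes V" "e \<in> nsets V m"
  shows "\<sigma> ` e \<in> nsets V m"
proof -
  have "inj_on \<sigma> e" using permutes_inj[OF assms(1)] by (rule inj_on_subset) simp
  moreover have "\<sigma> ` e \<subseteq> V"
    using permutes_image[OF assms(1)] assms(2) by (auto simp: nsets_def)
  ultimately show ?thesis using assms(2) by (auto simp: nsets_def card_image)
qed

text \<open>A bijection from \<open>e\<close> to \<open>f\<close> is glued to one between the
  complements, and extended by the identity outside \<open>V\<close>.\<close>

lemma permutes_transitive_nsets:
  assumes "finite V" "e \<in> nsets V m" "f \<in> nsets V m"
  obtains \<tau> where "\<tau> permutes V" "\<tau> ` e = f"
proof -
  have e: "e \<subseteq> V" "finite e" "card e = m" and f: "f \<subseteq> V" "finite f" "card f = m"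
    using assms by (auto simp: nsets_def)
  obtain g where g: "bij_betw g e f"
    using finite_same_card_bij e f by metis
  obtain h where h: "bij_betw h (V - e) (V - f)"
    using finite_same_card_bij[of "V - e" "V - f"] assms(1) e f by (auto simp: card_Diff_subset)
  let ?k = "\<lambda>x. if x \<in> e then g x else h x"
  let ?t = "\<lambda>x. if x \<in> V then ?k x else x"
  have "bij_betw ?k (e \<union> (V - e)) (f \<union> (V - f))"
    using g h by (intro bij_betw_disjoint_Un) auto
  then have "bij_betw ?k V V" using e(1) f(1) by (simp add: Un_absorb1)
  then have "bij_betw ?t V V" by (simp cong: bij_betw_cong)
  then have "?t permutes V" by (rule bij_imp_permutes) auto
  moreover have "?t ` e = f"
  proof -
    have "?t ` e = g ` e" using e(1) by (intro image_cong) auto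
    then show ?thesis using g by (simp add: bij_betw_def)
  qed
  ultimately show ?thesis by (rule that)
qed

text \<open>With denominators cleared: a uniformly random permutation maps a fixed
  \<open>m\<close>-set to a uniformly distributed one. By transitivity the count does not depend on
  \<open>e\<close>, and double counting the pairs of an \<open>m\<close>-set and a permutation
  mapping it into \<open>G\<close> gives its value.\<close>

lemma card_permutations_into:
  assumes V: "finite V" and e: "e \<in> nsets V m" and G: "G \<subseteq> nsets V m"
  shows "card {\<sigma>. \<sigma> permutes V \<and> \<sigma> ` e \<in> G} * (card V choose m) = fact (card V) * card G"
proof -
  define P where "P = {\<sigma>. \<sigma> permutes V}"
  have finP: "finite P" unfolding P_def using V by (rule finite_permutations)
  define N where "N f = card {\<sigma>\<in>P. \<sigma> ` f \<in> G}" for f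
  have le: "N f \<le> N f'" if ff: "f \<in> nsets V m" "f' \<in> nsets V m" for f f'
  proof -
    obtain \<tau> where \<tau>: "\<tau> permutes V" "\<tau> ` f' = f"
      using permutes_transitive_nsets[OF V ff(2) ff(1)] .
    \<comment> \<open>Precomposition with \<tau> turns permutations sending \<open>f\<close> into
      \<open>G\<close> into permutations sending \<open>f'\<close> into \<open>G\<close>.\<close>
    have "inj_on (\<lambda>\<sigma>. \<sigma> \<circ> \<tau>) {\<sigma>\<in>P. \<sigma> ` f \<in> G}"
    proof (rule inj_onI)
      fix a b assume "a \<circ> \<tau> = b \<circ> \<tau>"
      then show "a = b" using permutes_surj[OF \<tau>(1)]
        by (metis surj_fun_eq UNIV_I ext)
    qed
    moreover have "(\<lambda>\<sigma>. \<sigma> \<circ> \<tau>) ` {\<sigma>\<in>P. \<sigma> ` f \<in> G} \<subseteq> {\<sigma>\<in>P. \<sigma> ` f' \<in> G}"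
      using \<tau> by (auto simp: P_def image_comp intro: permutes_compose simp flip: \<tau>(2))
    ultimately show ?thesis unfolding N_def
      by (intro card_inj_on_le[of "\<lambda>\<sigma>. \<sigma> \<circ> \<tau>"]) (use finP in auto)
  qed
  have const: "N f = N e" if "f \<in> nsets V m" for f
    using le[OF that e] le[OF e that] by simp
  have each: "card {f\<in>nsets V m. \<sigma> ` f \<in> G} = card G" if "\<sigma> \<in> P" for \<sigma>
  proof -
    have s: "\<sigma> permutes V" using that by (simp add: P_def)
    have "bij_betw ((`) \<sigma>) {f\<in>nsets V m. \<sigma> ` f \<in> G} G"
    proof (rule bij_betw_byWitness[where f' = "(`) (inv \<sigma>)"])
      have *: "inv \<sigma> ` \<sigma> ` f = f" "\<sigma> ` inv \<sigma> ` f = f" for f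
        by (simp_all add: image_image permutes_inverses[OF s])
      show "\<forall>a\<in>{f \<in> nsets V m. \<sigma> ` f \<in> G}. inv \<sigma> ` \<sigma> ` a = a" using * by blast
      show "\<forall>a'\<in>G. \<sigma> ` inv \<sigma> ` a' = a'" using * by blast
      show "(`) \<sigma> ` {f \<in> nsets V m. \<sigma> ` f \<in> G} \<subseteq> G" by auto
      show "(`) (inv \<sigma>) ` G \<subseteq> {f \<in> nsets V m. \<sigma> ` f \<in> G}"
        using G * permutes_image_nsets[OF permutes_inv[OF s]] by auto
    qed
    then show ?thesis by (rule bij_betw_same_card)
  qed
  have "N e * (card V choose m) = (\<Sum>f\<in>nsets V m. N f)"
    using const card_nsets[OF V] by simp
  also have "\<dots> = (\<Sum>\<sigma>\<in>P. card {f\<in>nsets V m. \<sigma> ` f \<in> G})"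
    unfolding N_def by (intro sum_card_Collect_swap finP finite_imp_finite_nsets V)
  also have "\<dots> = card P * card G" using each by simp
  also have "card P = fact (card V)" unfolding P_def by (rule card_permutations[OF refl V])
  finally show ?thesis by (simp add: N_def P_def conj_commute)
qed

section \<open>Random subsets with independent elements\<close>

text \<open>The probability that the random subset of \<open>K\<close> containing each element independently with
  probability \<open>p\<close> equals \<open>W\<close>.\<close>

definition binomial_weight :: "'a set \<Rightarrow> real \<Rightarrow> 'a set \<Rightarrow> real" where
  "binomial_weight K p W = p ^ card W * (1 - p) ^ card (K - W)"

lemma binomial_weight_nonneg: "0 \<le> p \<Longrightarrow> p \<le> 1 \<Longrightarrow> 0 \<le> binomial_weight K p W"
  by (simp add: binomial_weight_def)

lemma sum_binomial_weight:
  assumes "finite K"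
  shows "(\<Sum>W\<in>Pow K. binomial_weight K p W) = 1"
  using prod_add[OF assms, of "\<lambda>_. p" "\<lambda>_. 1 - p"] by (simp add: binomial_weight_def)

text \<open>Independence appears as a product expansion: an element of \<open>B\<close> contributes
  the factor \<open>0 + (1 - p)\<close>, any other element of \<open>K\<close> the factor
  \<open>p + (1 - p) = 1\<close>.\<close>

lemma sum_binomial_weight_disjoint:
  assumes "finite K" "B \<subseteq> K"
  shows "(\<Sum>W\<in>Pow K. binomial_weight K p W * of_bool (W \<inter> B = {})) = (1 - p) ^ card B"
proof -
  have "(\<Sum>W\<in>Pow K. binomial_weight K p W * of_bool (W \<inter> B = {}))
      = (\<Sum>W\<in>Pow K. (\<Prod>i\<in>W. p * of_bool (i \<notin> B)) * (\<Prod>i\<in>K - W. 1 - p))"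
  proof (rule sum.cong[OF refl])
    fix W assume "W \<in> Pow K"
    then have W: "finite W" using assms(1) finite_subset by blast
    have "(\<Prod>i\<in>W. of_bool (i \<notin> B)) = (of_bool (W \<inter> B = {}) :: real)"
      using W by (auto simp: of_bool_def disjoint_iff intro!: prod.neutral)
    then show "binomial_weight K p W * of_bool (W \<inter> B = {})
        = (\<Prod>i\<in>W. p * of_bool (i \<notin> B)) * (\<Prod>i\<in>K - W. 1 - p)"
      by (simp add: binomial_weight_def prod.distrib)
  qed
  also have "\<dots> = (\<Prod>i\<in>K. p * of_bool (i \<notin> B) + (1 - p))"
    by (rule prod_add[OF assms(1), symmetric])
  also have "\<dots> = (\<Prod>i\<in>K. if i \<in> B then 1 - p else 1)"
    by (rule prod.cong) auto
  also have "\<dots> = (1 - p) ^ card B"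
    using assms by (simp add: prod.If_cases Int_absorb1)
  finally show ?thesis .
qed

lemma sum_binomial_weight_mem:
  assumes "finite K" "a \<in> K"
  shows "(\<Sum>W\<in>Pow K. binomial_weight K p W * of_bool (a \<in> W)) = p"
proof -
  have "(\<Sum>W\<in>Pow K. binomial_weight K p W * of_bool (a \<in> W)) =
     (\<Sum>W\<in>Pow K. binomial_weight K p W) -
     (\<Sum>W\<in>Pow K. binomial_weight K p W * of_bool (W \<inter> {a} = {}))"
    unfolding sum_subtractf[symmetric] by (intro sum.cong) auto
  then show ?thesis
    using sum_binomial_weight_disjoint[OF assms(1), of "{a}" p] assms sum_binomial_weight[OF assms(1)]
    by simp
qed

section \<open>The recursive construction\<close>

definition lo :: "nat \<Rightarrow> nat set \<Rightarrow> nat set" where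
  "lo k X = set (take k (sorted_list_of_set X))"

definition hi :: "nat \<Rightarrow> nat set \<Rightarrow> nat set" where
  "hi k X = set (drop k (sorted_list_of_set X))"

lemma lo_un_hi: "finite X \<Longrightarrow> lo k X \<union> hi k X = X"
  unfolding lo_def hi_def by (metis append_take_drop_id set_append set_sorted_list_of_set)

lemma card_lo: "finite X \<Longrightarrow> k \<le> card X \<Longrightarrow> card (lo k X) = k"
  by (simp add: lo_def distinct_card)

lemma card_hi: "finite X \<Longrightarrow> card (hi k X) = card X - k"
  by (simp add: hi_def distinct_card)

lemma lo_less_hi:
  assumes "x \<in> lo k X" "y \<in> hi k X"
  shows "x < y"
proof -
  have "sorted_wrt (<) (take k (sorted_list_of_set X) @ drop k (sorted_list_of_set X))"
    using strict_sorted_list_of_set by simp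
  then show ?thesis
    using assms unfolding sorted_wrt_append lo_def hi_def by blast
qed

text \<open>A strictly sorted list is determined by its set, so the sorted list of the union is the
  concatenation. This identifies the two parts of an edge assembled from \<open>A\<close> and
  \<open>B\<close>.\<close>

lemma lo_hi_Un:
  assumes "finite A" "finite B" "\<And>a b. a \<in> A \<Longrightarrow> b \<in> B \<Longrightarrow> a < b"
  shows "lo (card A) (A \<union> B) = A" "hi (card A) (A \<union> B) = B"
proof -
  have "sorted_list_of_set A @ sorted_list_of_set B = sorted_list_of_set (A \<union> B)"
    using assms by (intro strict_sorted_equal) (auto simp: sorted_wrt_append)
  then show "lo (card A) (A \<union> B) = A" "hi (card A) (A \<union> B) = B"
    unfolding lo_def hi_def using assms by (simp_all flip: \<open>_ = sorted_list_of_set (A \<union> B)\<close>)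
qed

text \<open>The permutation acts on the tail of \<open>X\<close> and not on \<open>G\<close>, so
  averaging over it only asks how often a given \<open>m\<close>-set is mapped into the fixed
  \<open>G\<close>.\<close>

definition turan_recursion ::
    "nat \<Rightarrow> nat \<Rightarrow> nat \<Rightarrow> nat \<Rightarrow> nat set set \<Rightarrow> nat set set \<Rightarrow> (nat \<Rightarrow> nat) \<Rightarrow> nat set set" where
  "turan_recursion n k R m W G \<sigma> =
     {X \<in> nsets {..<n} (k + R + m). lo k X \<in> W \<or>
        (W \<inter> nsets (lo (k + R) X) k = {} \<and> \<sigma> ` hi (k + R) X \<in> G)}"

lemma turan_system_turan_recursion:
  assumes G: "turan_system {..<n} (m + R) m G" and W: "W \<subseteq> nsets {..<n} k"
    and \<sigma>: "\<sigma> permutes {..<n}"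
  shows "turan_system {..<n} (k + R + m + R) (k + R + m) (turan_recursion n k R m W G \<sigma>)"
  unfolding turan_system_def r_graph_def
proof (intro conjI ballI)
  show "turan_recursion n k R m W G \<sigma> \<subseteq> nsets {..<n} (k + R + m)"
    by (auto simp: turan_recursion_def)
next
  fix S assume S: "S \<in> nsets {..<n} (k + R + m + R)"
  then have finS: "finite S" and subS: "S \<subseteq> {..<n}" and cardS: "card S = k + R + m + R"
    by (auto simp: nsets_def)
  define A where "A = lo (k + R) S"
  define Z where "Z = hi (k + R) S"
  have S_eq: "A \<union> Z = S" using lo_un_hi[OF finS] by (simp add: A_def Z_def)
  have fin: "finite A" "finite Z" by (auto simp: A_def Z_def lo_def hi_def)
  have cA: "card A = k + R" using card_lo[OF finS, of "k + R"] cardS by (simp add: A_def)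
  have cZ: "card Z = m + R" using card_hi[OF finS, of "k + R"] cardS by (simp add: Z_def)
  have AZ: "a < z" if "a \<in> A" "z \<in> Z" for a z
    using lo_less_hi that by (simp add: A_def Z_def)
  have subn: "A \<subseteq> {..<n}" "Z \<subseteq> {..<n}" using S_eq subS by auto
  show "\<exists>X\<in>turan_recursion n k R m W G \<sigma>. X \<subseteq> S"
  proof (cases "W \<inter> nsets A k = {}")
    case False
    then obtain K where K: "K \<in> W" "K \<subseteq> A" "finite K" "card K = k"
      by (auto simp: nsets_def)
    \<comment> \<open>All of \<open>K\<close> precedes \<open>Z\<close>, so \<open>K\<close> is
      exactly the initial segment of \<open>K \<union> Z\<close>, a set of size
      \<open>k + (m + R)\<close>.\<close>
    have KZ: "\<And>a b. a \<in> K \<Longrightarrow> b \<in> Z \<Longrightarrow> a < b" using AZ K(2) by blast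
    have "K \<inter> Z = {}" using KZ by blast
    then have "card (K \<union> Z) = k + R + m"
      using K fin cZ by (simp add: card_Un_disjoint)
    moreover have "lo k (K \<union> Z) = K" using lo_hi_Un(1)[OF K(3) fin(2) KZ] K(4) by simp
    ultimately have "K \<union> Z \<in> turan_recursion n k R m W G \<sigma>"
      using K fin subn by (auto simp: turan_recursion_def nsets_def)
    then show ?thesis using S_eq K(2) by blast
  next
    case True
    have "Z \<in> nsets {..<n} (m + R)" using subn fin cZ by (auto simp: nsets_def)
    \<comment> \<open>The covering property of \<open>G\<close> applies to the image of
      \<open>Z\<close>; the edge found there is pulled back to a subset \<open>e\<close> of
      \<open>Z\<close>.\<close>
    then have "\<sigma> ` Z \<in> nsets {..<n} (m + R)" by (rule permutes_image_nsets[OF \<sigma>])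
    then obtain e' where e': "e' \<in> G" "e' \<subseteq> \<sigma> ` Z"
      using G unfolding turan_system_def by blast
    then obtain e where e: "e \<subseteq> Z" "e' = \<sigma> ` e" by (meson subset_imageE)
    have fe: "finite e" using e(1) fin(2) finite_subset by blast
    have "inj_on \<sigma> e" using permutes_inj[OF \<sigma>] by (rule inj_on_subset) simp
    moreover have "card e' = m"
      using e'(1) G by (auto simp: turan_system_def r_graph_def nsets_def)
    ultimately have ce: "card e = m" using e(2) by (simp add: card_image)
    have Ae: "\<And>a b. a \<in> A \<Longrightarrow> b \<in> e \<Longrightarrow> a < b" using AZ e(1) by blast
    then have "A \<inter> e = {}" by blast
    then have "card (A \<union> e) = k + R + m" using fin fe cA ce by (simp add: card_Un_disjoint)
    moreover have "lo (k + R) (A \<union> e) = A" "hi (k + R) (A \<union> e) = e"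
      using lo_hi_Un[OF fin(1) fe Ae] cA by simp_all
    ultimately have "A \<union> e \<in> turan_recursion n k R m W G \<sigma>"
      using True subn fin fe e e' by (auto simp: turan_recursion_def nsets_def)
    then show ?thesis using S_eq e(1) by blast
  qed
qed

text \<open>A union bound over the two kinds of edges. The factors depending on \<open>W\<close> and
  on \<sigma> are separated, so that their averages multiply.\<close>

lemma card_turan_recursion_le:
  "real (card (turan_recursion n k R m W G \<sigma>)) \<le>
    (\<Sum>X\<in>nsets {..<n} (k + R + m). of_bool (lo k X \<in> W) +
       of_bool (W \<inter> nsets (lo (k + R) X) k = {}) * of_bool (\<sigma> ` hi (k + R) X \<in> G))"
proof -
  let ?N = "nsets {..<n} (k + R + m)"
  let ?P = "\<lambda>X. lo k X \<in> W \<or> (W \<inter> nsets (lo (k + R) X) k = {} \<and> \<sigma> ` hi (k + R) X \<in> G)"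
  have fin: "finite ?N" by (simp add: finite_imp_finite_nsets)
  have "real (card (turan_recursion n k R m W G \<sigma>)) = (\<Sum>X\<in>?N. of_bool (?P X))"
    using fin by (simp add: turan_recursion_def of_bool_def sum.If_cases Int_def)
  also have "\<dots> \<le> (\<Sum>X\<in>?N. of_bool (lo k X \<in> W) +
       of_bool (W \<inter> nsets (lo (k + R) X) k = {}) * of_bool (\<sigma> ` hi (k + R) X \<in> G))"
    by (intro sum_mono) (auto simp: of_bool_def)
  finally show ?thesis .
qed

text \<open>The minimum is at most the expected size over independent random \<open>W\<close> and
  \<sigma>. For each \<open>X\<close> the first alternative has probability \<open>p\<close>; the
  second is the product of \<open>(1 - p) ^ ((k + R) choose k)\<close>, for the
  \<open>k\<close>-subsets of the first \<open>k + R\<close> elements all missing from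
  \<open>W\<close>, and the edge ratio of \<open>G\<close>.\<close>

lemma turan_ratio_recursion:
  assumes p: "0 \<le> p" "p \<le> 1" and n: "k + R + m \<le> n"
  shows "turan_ratio (k + R + m + R) (k + R + m) n
    \<le> p + (1 - p) ^ ((k + R) choose k) * turan_ratio (m + R) m n"
proof -
  define r where "r = k + R + m"
  define T where "T = real (turan_number n (r + R) r)"
  define \<P> where "\<P> = {\<sigma>. \<sigma> permutes {..<n}}"
  define K where "K = nsets {..<n} k"
  define w where "w W = binomial_weight K p W" for W
  obtain G where G: "turan_system {..<n} (m + R) m G" "card G = turan_number n (m + R) m"
    using optimal_turan_system[of m "m + R"] by auto
  have Gsub: "G \<subseteq> nsets {..<n} m" using G(1) by (auto simp: turan_system_def r_graph_def)
  have finK: "finite K" by (simp add: K_def finite_imp_finite_nsets)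
  have fin\<P>: "finite \<P>" by (simp add: \<P>_def finite_permutations)
  have card\<P>: "card \<P> = fact n" unfolding \<P>_def by (rule card_permutations) auto
  let ?I = "\<lambda>W X. of_bool (lo k X \<in> W) :: real"
  let ?J = "\<lambda>W X. of_bool (W \<inter> nsets (lo (k + R) X) k = {}) :: real"
  let ?H = "\<lambda>\<sigma> X. of_bool (\<sigma> ` hi (k + R) X \<in> G) :: real"
  have T_le: "T \<le> (\<Sum>X\<in>nsets {..<n} r. ?I W X + ?J W X * ?H \<sigma> X)"
    if "W \<in> Pow K" "\<sigma> \<in> \<P>" for W \<sigma>
  proof -
    have "turan_number (card {..<n}) (k + R + m + R) (k + R + m) \<le> card (turan_recursion n k R m W G \<sigma>)"
      using that by (intro turan_number_le_card turan_system_turan_recursion[OF G(1)])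
        (auto simp: K_def \<P>_def)
    then have "T \<le> real (card (turan_recursion n k R m W G \<sigma>))" by (simp add: T_def r_def)
    also have "\<dots> \<le> (\<Sum>X\<in>nsets {..<n} r. ?I W X + ?J W X * ?H \<sigma> X)"
      unfolding r_def by (rule card_turan_recursion_le)
    finally show ?thesis .
  qed
  \<comment> \<open>\<open>T\<close> is averaged as a constant: the weights of \<open>W\<close> sum
    to 1 and there are \<open>fact n\<close> permutations.\<close>
  have "fact n * T = (\<Sum>W\<in>Pow K. w W * (\<Sum>\<sigma>\<in>\<P>. T))"
    using sum_binomial_weight[OF finK, of p]
    by (simp add: w_def card\<P> sum_distrib_right[symmetric])
  also have "\<dots> \<le> (\<Sum>W\<in>Pow K. w W * (\<Sum>\<sigma>\<in>\<P>. \<Sum>X\<in>nsets {..<n} r. ?I W X + ?J W X * ?H \<sigma> X))"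
    using T_le p by (intro sum_mono mult_left_mono) (auto simp: w_def binomial_weight_nonneg)
  also have "\<dots> = (\<Sum>W\<in>Pow K. \<Sum>X\<in>nsets {..<n} r. w W * (\<Sum>\<sigma>\<in>\<P>. ?I W X + ?J W X * ?H \<sigma> X))"
    by (simp add: sum.swap[of _ _ \<P>] sum_distrib_left)
  also have "\<dots> = (\<Sum>X\<in>nsets {..<n} r. \<Sum>W\<in>Pow K. w W * (\<Sum>\<sigma>\<in>\<P>. ?I W X + ?J W X * ?H \<sigma> X))"
    by (rule sum.swap)
  also have "\<dots> = (\<Sum>X\<in>nsets {..<n} r.
      fact n * (p + (1 - p) ^ ((k + R) choose k) * turan_ratio (m + R) m n))"
  \<comment> \<open>The contribution of a single \<open>X\<close> turns out not to depend on
    \<open>X\<close>.\<close>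
  proof (rule sum.cong[OF refl])
    fix X assume "X \<in> nsets {..<n} r"
    then have X: "X \<subseteq> {..<n}" "finite X" "card X = r" by (auto simp: nsets_def)
    have sub: "lo j X \<subseteq> {..<n}" "hi j X \<subseteq> {..<n}" for j
      using lo_un_hi[OF X(2), of j] X(1) by auto
    have loK: "lo k X \<in> K"
      using sub card_lo[OF X(2), of k] X(3) by (auto simp: K_def nsets_def r_def lo_def)
    have BK: "nsets (lo (k + R) X) k \<subseteq> K" unfolding K_def using sub by (intro nsets_mono)
    have cB: "card (nsets (lo (k + R) X) k) = (k + R) choose k"
      using card_nsets[of "lo (k + R) X" k] card_lo[OF X(2), of "k + R"] X(3)
      by (simp add: r_def lo_def)
    have hiN: "hi (k + R) X \<in> nsets {..<n} m"
      using sub card_hi[OF X(2), of "k + R"] X(3) by (auto simp: nsets_def r_def hi_def)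
    have "card {\<sigma>. \<sigma> permutes {..<n} \<and> \<sigma> ` hi (k + R) X \<in> G} * (n choose m) = fact n * card G"
      using card_permutations_into[OF _ hiN Gsub] by simp
    then have "real (card {\<sigma>. \<sigma> permutes {..<n} \<and> \<sigma> ` hi (k + R) X \<in> G}) * real (n choose m)
        = fact n * real (card G)"
      by (metis of_nat_fact of_nat_mult)
    moreover have "real (n choose m) > 0" using n by simp
    ultimately have "real (card {\<sigma>. \<sigma> permutes {..<n} \<and> \<sigma> ` hi (k + R) X \<in> G})
        = fact n * turan_ratio (m + R) m n"
      by (simp add: turan_ratio_def G(2) field_simps)
    then have H: "(\<Sum>\<sigma>\<in>\<P>. ?H \<sigma> X) = fact n * turan_ratio (m + R) m n"
      using fin\<P> by (simp add: of_bool_def sum.If_cases \<P>_def Int_def)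
    have "(\<Sum>W\<in>Pow K. w W * (\<Sum>\<sigma>\<in>\<P>. ?I W X + ?J W X * ?H \<sigma> X))
        = (\<Sum>W\<in>Pow K. fact n * (w W * ?I W X)
            + fact n * turan_ratio (m + R) m n * (w W * ?J W X))"
      using H by (intro sum.cong refl)
        (simp add: sum.distrib card\<P> sum_distrib_left[symmetric] algebra_simps)
    also have "\<dots> = fact n * (\<Sum>W\<in>Pow K. w W * ?I W X)
        + fact n * turan_ratio (m + R) m n * (\<Sum>W\<in>Pow K. w W * ?J W X)"
      by (simp only: sum.distrib sum_distrib_left)
    also have "\<dots> = fact n * (p + (1 - p) ^ ((k + R) choose k) * turan_ratio (m + R) m n)"
      unfolding w_def sum_binomial_weight_mem[OF finK loK]
        sum_binomial_weight_disjoint[OF finK BK] cB by (simp add: algebra_simps)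
    finally show "(\<Sum>W\<in>Pow K. w W * (\<Sum>\<sigma>\<in>\<P>. ?I W X + ?J W X * ?H \<sigma> X))
        = fact n * (p + (1 - p) ^ ((k + R) choose k) * turan_ratio (m + R) m n)" .
  qed
  also have "\<dots> = fact n * ((p + (1 - p) ^ ((k + R) choose k) * turan_ratio (m + R) m n) * real (n choose r))"
    by (simp add: card_nsets)
  finally have "T \<le> (p + (1 - p) ^ ((k + R) choose k) * turan_ratio (m + R) m n) * real (n choose r)"
    by simp
  moreover have "real (n choose r) > 0" using n by (simp add: r_def)
  ultimately show ?thesis
    unfolding turan_ratio_def[of "k + R + m + R"] by (simp add: T_def r_def pos_divide_le_eq)
qed

text \<open>The coefficients do not involve \<open>n\<close>, so the inequality between ratios
  passes to the limit.\<close>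

lemma turan_density_recursion:
  assumes "0 \<le> p" "p \<le> 1"
  shows "turan_density (k + R + m + R) (k + R + m)
    \<le> p + (1 - p) ^ ((k + R) choose k) * turan_density (m + R) m"
proof (rule LIMSEQ_le)
  show "turan_ratio (k + R + m + R) (k + R + m) \<longlonglongrightarrow> turan_density (k + R + m + R) (k + R + m)"
    by (rule turan_ratio_tendsto) simp
  show "(\<lambda>n. p + (1 - p) ^ ((k + R) choose k) * turan_ratio (m + R) m n)
      \<longlonglongrightarrow> p + (1 - p) ^ ((k + R) choose k) * turan_density (m + R) m"
    by (intro tendsto_intros turan_ratio_tendsto) simp
  show "\<exists>N. \<forall>n\<ge>N. turan_ratio (k + R + m + R) (k + R + m) n
      \<le> p + (1 - p) ^ ((k + R) choose k) * turan_ratio (m + R) m n"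
    using turan_ratio_recursion[OF assms] by blast
qed

lemma turan_density_le_1:
  assumes "r \<le> s"
  shows "turan_density s r \<le> 1"
  using turan_ratio_tendsto[OF assms] by (rule LIMSEQ_le_const2) (use turan_ratio_le_1[OF assms] in blast)

text \<open>The exponential form needs no bound \<open>p \<le> 1\<close>: for larger \<open>p\<close> the right-hand side exceeds 1.\<close>

lemma turan_density_recursion_exp:
  assumes "0 \<le> p"
  shows "turan_density (k + R + m + R) (k + R + m)
    \<le> p + exp (- (p * real ((k + R) choose R))) * turan_density (m + R) m"
proof (cases "p \<le> 1")
  case True
  let ?N = "(k + R) choose k"
  have t: "0 \<le> turan_density (m + R) m" by (rule turan_density_nonneg) simp
  have "(1 - p) ^ ?N \<le> exp (- p) ^ ?N"
    using True exp_ge_add_one_self[of "- p"] by (intro power_mono) auto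
  also have "\<dots> = exp (- (p * real ?N))" by (simp add: exp_of_nat_mult[symmetric] mult.commute)
  finally have "(1 - p) ^ ?N \<le> exp (- (p * real ((k + R) choose R)))"
    using binomial_symmetric[of k "k + R"] by simp
  then have "(1 - p) ^ ?N * turan_density (m + R) m
      \<le> exp (- (p * real ((k + R) choose R))) * turan_density (m + R) m"
    using t by (intro mult_right_mono)
  with turan_density_recursion[OF assms True, of k R m] show ?thesis by linarith
next
  case False
  have "0 \<le> exp (- (p * real ((k + R) choose R))) * turan_density (m + R) m"
    by (intro mult_nonneg_nonneg turan_density_nonneg) auto
  then show ?thesis
    using False turan_density_le_1[of "k + R + m" "k + R + m + R"] by linarith
qed

section \<open>Asymptotics\<close>

text \<open>\<open>GREATEST\<close> is meaningful only once a largest root exists. The exponential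
  dominates beyond some \<open>M\<close>, the intermediate value theorem gives a root in
  \<open>{1..M}\<close>, and the roots in this interval form a compact set, which has a
  maximum.\<close>

lemma c0_properties:
  assumes "R \<ge> 1"
  shows "c0 R > 0" "exp (c0 R) = (c0 R + 1) ^ (R + 1)"
proof -
  have "((\<lambda>c::real. (c + 1) ^ (R + 1) / exp (c + 1)) \<longlongrightarrow> 0) at_top"
    by (rule filterlim_compose[OF tendsto_power_div_exp_0])
      (rule filterlim_tendsto_add_at_top[OF tendsto_const filterlim_ident, of 1, simplified add.commute])
  then have "eventually (\<lambda>c::real. (c + 1) ^ (R + 1) / exp (c + 1) < exp (- 1)) at_top"
    by (rule order_tendstoD) simp
  then obtain M0 where M0: "\<And>c::real. c \<ge> M0 \<Longrightarrow> (c + 1) ^ (R + 1) / exp (c + 1) < exp (- 1)"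
    by (auto simp: eventually_at_top_linorder)
  define M where "M = max M0 1"
  have M: "(c + 1) ^ (R + 1) < exp c" if "c \<ge> M" for c :: real
  proof -
    have "(c + 1) ^ (R + 1) < exp (- 1) * exp (c + 1)"
      using M0[of c] that by (simp add: M_def pos_divide_less_eq)
    also have "\<dots> = exp c" by (simp flip: exp_add)
    finally show ?thesis .
  qed
  define Z where "Z = {c \<in> {1..M}. exp c - (c + 1) ^ (R + 1) = 0}"
  \<comment> \<open>At \<open>c = 1\<close> the difference \<open>exp c - (c + 1) ^ (R + 1)\<close>
    is at most 0, while at \<open>M\<close> it is positive.\<close>
  have "exp (1::real) \<le> 2 ^ 2" using exp_le by simp
  also have "\<dots> \<le> 2 ^ (R + 1)" using assms by (intro power_increasing) auto
  finally have "\<exists>c\<ge>1. c \<le> M \<and> exp c - (c + 1) ^ (R + 1) = 0"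
    using M[of M] by (intro IVT') (auto simp: M_def intro!: continuous_intros)
  then have "Z \<noteq> {}" by (auto simp: Z_def)
  moreover have "compact Z"
  proof -
    have "closed {c::real. exp c - (c + 1) ^ (R + 1) = 0}"
      by (intro closed_Collect_eq continuous_intros)
    then have "compact ({1..M} \<inter> {c::real. exp c - (c + 1) ^ (R + 1) = 0})"
      by (intro compact_Int_closed) simp_all
    moreover have "Z = {1..M} \<inter> {c. exp c - (c + 1) ^ (R + 1) = 0}" by (auto simp: Z_def)
    ultimately show ?thesis by simp
  qed
  ultimately obtain c where c: "c \<in> Z" "\<And>t. t \<in> Z \<Longrightarrow> t \<le> c"
    using compact_attains_sup[of Z] by blast
  have "c0 R = c"
    unfolding c0_def
  proof (rule Greatest_equality)
    show "exp c = (c + 1) ^ (R + 1)" using c(1) by (simp add: Z_def)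
    fix y :: real assume y: "exp y = (y + 1) ^ (R + 1)"
    then have "y < M" using M[of y] by (cases "y \<ge> M") auto
    \<comment> \<open>Roots below 1, such as 0, lie outside \<open>Z\<close> but cannot exceed
      \<open>c\<close>.\<close>
    then have "y \<in> Z \<or> y < 1" using y by (auto simp: Z_def)
    moreover have "1 \<le> c" using c(1) by (simp add: Z_def)
    ultimately show "y \<le> c" using c(2) by fastforce
  qed
  then show "c0 R > 0" "exp (c0 R) = (c0 R + 1) ^ (R + 1)" using c(1) by (auto simp: Z_def)
qed

text \<open>Raising \<open>R\<close> by one multiplies the quotient of binomials by
  \<open>(k r + Suc R) / (r + Suc R)\<close>, which tends to \<open>x\<close>.\<close>

lemma choose_ratio_tendsto:
  assumes "(\<lambda>r. real (k r) / real r) \<longlonglongrightarrow> x"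
  shows "(\<lambda>r. real ((k r + R) choose R) / real ((r + R) choose R)) \<longlonglongrightarrow> x ^ R"
proof (induction R)
  case 0
  show ?case by simp
next
  case (Suc R)
  have "(\<lambda>r. (real (k r) / real r + real (Suc R) * inverse (real r)) / (1 + real (Suc R) * inverse (real r)))
      \<longlonglongrightarrow> (x + real (Suc R) * 0) / (1 + real (Suc R) * 0)"
    by (intro tendsto_intros assms lim_inverse_n) simp
  moreover have "eventually (\<lambda>r. (real (k r) / real r + real (Suc R) * inverse (real r)) /
      (1 + real (Suc R) * inverse (real r)) = real (k r + Suc R) / real (r + Suc R)) sequentially"
    using eventually_gt_at_top[of 0]
  proof eventually_elim
    case (elim r)
    then have "real (k r) / real r + real (Suc R) * inverse (real r) = real (k r + Suc R) / real r"
      "1 + real (Suc R) * inverse (real r) = real (r + Suc R) / real r"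
      by (simp_all add: divide_simps)
    then show ?case using elim by simp
  qed
  ultimately have "(\<lambda>r. real (k r + Suc R) / real (r + Suc R)) \<longlonglongrightarrow> (x + real (Suc R) * 0) / (1 + real (Suc R) * 0)"
    by (rule Lim_transform_eventually)
  then have "(\<lambda>r. real (k r + Suc R) / real (r + Suc R)) \<longlonglongrightarrow> x" by simp
  from tendsto_mult[OF this Suc.IH]
  have "(\<lambda>r. real (k r + Suc R) / real (r + Suc R) *
      (real ((k r + R) choose R) / real ((r + R) choose R))) \<longlonglongrightarrow> x ^ Suc R" by simp
  moreover have "real ((k r + Suc R) choose Suc R) / real ((r + Suc R) choose Suc R) =
      real (k r + Suc R) / real (r + Suc R) * (real ((k r + R) choose R) / real ((r + R) choose R))" for r
  proof -
    have *: "real (Suc R) * real ((j + Suc R) choose Suc R) = real (j + Suc R) * real ((j + R) choose R)" for j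
      using Suc_times_binomial_eq[of "j + R" R] by (metis add_Suc_right mult.commute of_nat_mult)
    have "real ((k r + Suc R) choose Suc R) / real ((r + Suc R) choose Suc R) =
        (real (Suc R) * real ((k r + Suc R) choose Suc R)) /
        (real (Suc R) * real ((r + Suc R) choose Suc R))"
      by (rule mult_divide_mult_cancel_left[OF of_nat_neq_0, symmetric])
    then show ?thesis by (simp only: * times_divide_times_eq)
  qed
  ultimately show ?case by (simp only:)
qed

text \<open>For \<open>Q\<close> slightly above the fixed point
  \<open>\<alpha> / (1 - \<beta>)\<close>, the excess \<open>b\<close> of \<open>a\<close> over
  \<open>Q\<close> satisfies \<open>b r \<le> q * b (m r)\<close> with \<open>q < 1\<close>. It is
  bounded because \<open>m r < r\<close>, and since \<open>m\<close> tends to infinity the recursion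
  can be iterated any fixed number of times.\<close>

lemma eventually_le_of_contraction:
  fixes a A B :: "nat \<Rightarrow> real"
  assumes a: "\<And>r. 0 \<le> a r" and rec: "eventually (\<lambda>r. a r \<le> A r + B r * a (m r)) sequentially"
    and m: "eventually (\<lambda>r. m r < r) sequentially" "filterlim m at_top sequentially"
    and A: "A \<longlonglongrightarrow> \<alpha>" and B: "B \<longlonglongrightarrow> \<beta>" and \<beta>: "0 \<le> \<beta>" "\<beta> < 1" and \<delta>: "0 < \<delta>"
  shows "eventually (\<lambda>r. a r \<le> \<alpha> / (1 - \<beta>) + \<delta>) sequentially"
proof -
  \<comment> \<open>The slack \<open>t\<close> absorbs the errors in \<open>A\<close> and
    \<open>B\<close>; it is chosen so small that the perturbed fixed point moves by less than
    \<open>\<delta> / 2\<close>.\<close>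
  have "((\<lambda>t. (\<alpha> + t) / (1 - \<beta> - t)) \<longlongrightarrow> (\<alpha> + 0) / (1 - \<beta> - 0)) (at_right 0)"
    using \<beta> by (intro tendsto_intros) auto
  then have "eventually (\<lambda>t. (\<alpha> + t) / (1 - \<beta> - t) < \<alpha> / (1 - \<beta>) + \<delta> / 2) (at_right 0)"
    using \<delta> by (intro order_tendstoD) auto
  moreover have "eventually (\<lambda>t. 0 < t \<and> t < 1 - \<beta>) (at_right 0)"
    using eventually_at_right_real[of 0 "1 - \<beta>"] \<beta> by simp
  ultimately have "eventually (\<lambda>t. (\<alpha> + t) / (1 - \<beta> - t) < \<alpha> / (1 - \<beta>) + \<delta> / 2 \<and>
      0 < t \<and> t < 1 - \<beta>) (at_right 0)" by eventually_elim auto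
  then obtain t where t: "(\<alpha> + t) / (1 - \<beta> - t) < \<alpha> / (1 - \<beta>) + \<delta> / 2" "0 < t" "t < 1 - \<beta>"
    using eventually_happens trivial_limit_at_right_real by blast
  define q where "q = \<beta> + t"
  define Q where "Q = (\<alpha> + t) / (1 - q)"
  \<comment> \<open>Truncation at 0 keeps \<open>q * b (m r)\<close> a valid bound when
    \<open>a (m r)\<close> lies below \<open>Q\<close>.\<close>
  define b where "b r = max 0 (a r - Q)" for r
  have q: "0 < q" "q < 1" using t \<beta> by (auto simp: q_def)
  have Q: "\<alpha> + t = Q * (1 - q)" using q by (simp add: Q_def)
  have "eventually (\<lambda>r. A r < \<alpha> + t) sequentially" "eventually (\<lambda>r. B r < q) sequentially"
    using A B t by (auto intro!: order_tendstoD simp: q_def)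
  with rec m(1) have "eventually (\<lambda>r. b r \<le> q * b (m r) \<and> m r < r) sequentially"
  proof eventually_elim
    case (elim r)
    have "B r * a (m r) \<le> q * a (m r)" using elim a by (intro mult_right_mono) auto
    then have "a r - Q \<le> q * (a (m r) - Q)" using elim Q by (simp add: algebra_simps)
    also have "\<dots> \<le> q * b (m r)" using q by (intro mult_left_mono) (auto simp: b_def)
    finally have "a r - Q \<le> q * b (m r)" .
    moreover have "0 \<le> q * b (m r)" using q by (auto simp: b_def)
    ultimately show ?case using elim by (simp add: b_def)
  qed
  then obtain r0 where r0: "\<And>r. r \<ge> r0 \<Longrightarrow> b r \<le> q * b (m r)" "\<And>r. r \<ge> r0 \<Longrightarrow> m r < r"
    by (auto simp: eventually_sequentially)
  define M where "M = Max (b ` {..r0})"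
  have bM: "b r \<le> M" for r
  proof (induction r rule: less_induct)
    case (less r)
    show ?case
    proof (cases "r \<le> r0")
      case True
      then show ?thesis by (auto simp: M_def)
    next
      case False
      then have "b r \<le> q * b (m r)" using r0 by simp
      also have "\<dots> \<le> 1 * b (m r)" using q by (intro mult_right_mono) (auto simp: b_def)
      also have "\<dots> \<le> M" using less.IH r0(2)[of r] False by simp
      finally show ?thesis .
    qed
  qed
  have iter: "eventually (\<lambda>r. b r \<le> q ^ j * M) sequentially" for j
  proof (induction j)
    case 0
    show ?case using bM by simp
  next
    case (Suc j)
    \<comment> \<open>A bound valid for all large arguments holds at \<open>m r\<close> for all
      large \<open>r\<close>.\<close>
    have "eventually (\<lambda>r. b (m r) \<le> q ^ j * M) sequentially"
      using m(2) Suc.IH unfolding filterlim_iff by blast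
    with eventually_ge_at_top[of r0] show ?case
    proof eventually_elim
      case (elim r)
      have "b r \<le> q * b (m r)" using elim r0 by simp
      also have "\<dots> \<le> q * (q ^ j * M)" using elim q by (intro mult_left_mono) auto
      finally show ?case by simp
    qed
  qed
  have "(\<lambda>j. q ^ j * M) \<longlonglongrightarrow> 0 * M"
    using q by (intro tendsto_intros LIMSEQ_realpow_zero) auto
  then have "eventually (\<lambda>j. q ^ j * M < \<delta> / 2) sequentially"
    using \<delta> by (intro order_tendstoD) auto
  then obtain j where j: "q ^ j * M < \<delta> / 2" by (auto simp: eventually_sequentially)
  have Q_less: "Q < \<alpha> / (1 - \<beta>) + \<delta> / 2" using t(1) by (simp add: Q_def q_def algebra_simps)
  from iter[of j] show ?thesis
  proof eventually_elim
    case (elim r)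
    then have "a r - Q \<le> q ^ j * M" by (simp add: b_def)
    then show ?case using Q_less j by simp
  qed
qed

lemma floor_mult_ratio_tendsto:
  assumes "0 \<le> x"
  shows "(\<lambda>r. real (nat \<lfloor>x * real r\<rfloor>) / real r) \<longlonglongrightarrow> x"
proof (rule tendsto_sandwich)
  show "(\<lambda>r. x - inverse (real r)) \<longlonglongrightarrow> x"
    using tendsto_diff[OF tendsto_const lim_inverse_n, of x] by simp
  show "eventually (\<lambda>r. x - inverse (real r) \<le> real (nat \<lfloor>x * real r\<rfloor>) / real r) sequentially"
    using eventually_gt_at_top[of 0]
  proof eventually_elim
    case (elim r)
    have "x * real r - 1 \<le> real (nat \<lfloor>x * real r\<rfloor>)" by linarith
    then have "(x * real r - 1) / real r \<le> real (nat \<lfloor>x * real r\<rfloor>) / real r"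
      by (intro divide_right_mono) auto
    then show ?case using elim by (simp add: field_simps)
  qed
  show "eventually (\<lambda>r. real (nat \<lfloor>x * real r\<rfloor>) / real r \<le> x) sequentially"
    using eventually_gt_at_top[of 0]
  proof eventually_elim
    case (elim r)
    have "0 \<le> x * real r" using assms by simp
    then have "real (nat \<lfloor>x * real r\<rfloor>) \<le> x * real r" by linarith
    then show ?case using elim by (simp add: field_simps)
  qed
qed simp

section \<open>The rescaled recursion and its limit\<close>

definition scaled_density :: "nat \<Rightarrow> nat \<Rightarrow> real" where
  "scaled_density R r = turan_density (r + R) r * real ((r + R) choose R)"

text \<open>The choice \<open>p = c / ((k + R) choose R)\<close> makes the exponent in the density
  recursion exactly \<open>- c\<close>.\<close>

lemma scaled_density_recursion:
  assumes "0 \<le> c" "r = k + R + m"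
  shows "scaled_density R r \<le> c * (real ((r + R) choose R) / real ((k + R) choose R)) +
    exp (- c) * (real ((r + R) choose R) / real ((m + R) choose R)) * scaled_density R m"
proof -
  have pos: "real ((j + R) choose R) > 0" for j by simp
  define p where "p = c / real ((k + R) choose R)"
  have "0 \<le> p" using assms by (simp add: p_def)
  moreover have "p * real ((k + R) choose R) = c" using pos[of k] by (simp add: p_def)
  ultimately have "turan_density (r + R) r \<le> p + exp (- c) * turan_density (m + R) m"
    using turan_density_recursion_exp[of p k R m] assms(2) by simp
  then have "scaled_density R r
      \<le> (p + exp (- c) * turan_density (m + R) m) * real ((r + R) choose R)"
    unfolding scaled_density_def by (intro mult_right_mono) auto
  also have "turan_density (m + R) m = scaled_density R m / real ((m + R) choose R)"
    using pos[of m] by (simp add: scaled_density_def)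
  finally show ?thesis by (simp add: p_def algebra_simps)
qed

text \<open>With \<open>k r / r\<close> tending to \<open>x\<close> and \<open>m r / r\<close> to
  \<open>1 - x\<close>, the recursion has limiting coefficients \<open>c / x ^ R\<close> and
  \<open>exp (- c) / (1 - x) ^ R\<close>; the contraction lemma applies and its fixed point is
  \<open>mu R\<close>.\<close>

lemma eventually_scaled_density_le:
  assumes R: "R \<ge> 1" and \<delta>: "\<delta> > 0"
  shows "eventually (\<lambda>r. scaled_density R r \<le> mu R + \<delta>) sequentially"
proof -
  define c where "c = c0 R"
  \<comment> \<open>Setting both partial derivatives of the limiting fixed point in \<open>c\<close>
    and \<open>x\<close> to zero gives this \<open>x\<close> together with the equation defining
    \<open>c0 R\<close>.\<close>
  define x where "x = c / (c + 1)"
  define k where "k r = nat \<lfloor>x * real r\<rfloor>" for r :: nat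
  define m where "m r = r - k r - R" for r
  have c: "c > 0" "exp c = (c + 1) ^ (R + 1)" using c0_properties[OF R] by (auto simp: c_def)
  have x: "0 < x" "x < 1" "1 - x = 1 / (c + 1)" using c by (auto simp: x_def field_simps)
  have k: "(\<lambda>r. real (k r) / real r) \<longlonglongrightarrow> x"
    unfolding k_def using x by (intro floor_mult_ratio_tendsto) auto
  have lim: "(\<lambda>r. 1 - real (k r) / real r - real R * inverse (real r)) \<longlonglongrightarrow> 1 - x"
    using tendsto_diff[OF tendsto_diff[OF tendsto_const k] tendsto_mult[OF tendsto_const lim_inverse_n], of 1 "real R"]
    by simp
  have "eventually (\<lambda>r. 1 - real (k r) / real r - real R * inverse (real r) > 0) sequentially"
    using order_tendstoD(1)[OF lim, of 0] x(2) by simp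
  \<comment> \<open>This makes the truncated subtraction in \<open>m\<close> exact, so that
    \<open>r = k r + R + m r\<close> for large \<open>r\<close>.\<close>
  with eventually_gt_at_top[of 0] have kr: "eventually (\<lambda>r. 0 < r \<and> k r + R \<le> r) sequentially"
  proof eventually_elim
    case (elim r)
    have "1 - real (k r) / real r - real R * inverse (real r) = (real r - real (k r) - real R) / real r"
      using elim(1) by (simp add: diff_divide_distrib divide_inverse[of "real R"])
    then have "0 < real r - real (k r) - real R" using elim by (simp add: zero_less_divide_iff)
    then show ?case using elim by linarith
  qed
  then have "eventually (\<lambda>r. 1 - real (k r) / real r - real R * inverse (real r) = real (m r) / real r) sequentially"
    by eventually_elim (simp add: m_def field_simps of_nat_diff)
  with lim have m: "(\<lambda>r. real (m r) / real r) \<longlonglongrightarrow> 1 - x"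
    by (rule Lim_transform_eventually)
  have "filterlim (\<lambda>r. real (m r) / real r * real r) at_top sequentially"
    using x(2) by (intro filterlim_tendsto_pos_mult_at_top[OF m] filterlim_real_sequentially) simp
  moreover have "eventually (\<lambda>r. real (m r) / real r * real r = real (m r)) sequentially"
    using eventually_gt_at_top[of 0] by eventually_elim simp
  ultimately have "filterlim (\<lambda>r. real (m r)) at_top sequentially"
    by (simp cong: filterlim_cong)
  then have m_top: "filterlim m at_top sequentially"
    by (simp add: filterlim_sequentially_iff_filterlim_real)
  have ratio: "(\<lambda>r. real ((r + R) choose R) / real ((j r + R) choose R)) \<longlonglongrightarrow> inverse (y ^ R)"
    if "(\<lambda>r. real (j r) / real r) \<longlonglongrightarrow> y" "0 < y" for j y
    using tendsto_inverse[OF choose_ratio_tendsto[OF that(1), of R]] that(2) by simp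
  \<comment> \<open>The equation of \<open>c0\<close> enters here: it collapses the contraction
    factor \<open>exp (- c) * (c + 1) ^ R\<close> to \<open>1 / (c + 1)\<close>.\<close>
  have \<beta>: "exp (- c) * inverse ((1 - x) ^ R) = 1 / (c + 1)"
  proof -
    have "exp (- c) * inverse ((1 - x) ^ R) = (c + 1) ^ R / ((c + 1) * (c + 1) ^ R)"
      by (simp add: x(3) exp_minus c(2) power_inverse divide_inverse)
    then show ?thesis using c(1) by simp
  qed
  have "eventually (\<lambda>r. scaled_density R r \<le>
      c * inverse (x ^ R) / (1 - exp (- c) * inverse ((1 - x) ^ R)) + \<delta>) sequentially"
  proof (rule eventually_le_of_contraction[OF _ _ _ m_top _ _ _ _ \<delta>])
    show "0 \<le> scaled_density R r" for r
      by (simp add: scaled_density_def turan_density_nonneg)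
    show "eventually (\<lambda>r. scaled_density R r \<le>
        c * (real ((r + R) choose R) / real ((k r + R) choose R)) +
        exp (- c) * (real ((r + R) choose R) / real ((m r + R) choose R)) * scaled_density R (m r)) sequentially"
      using kr by eventually_elim (rule scaled_density_recursion, use c in \<open>auto simp: m_def\<close>)
    show "eventually (\<lambda>r. m r < r) sequentially"
      using kr by eventually_elim (use R in \<open>auto simp: m_def\<close>)
    show "(\<lambda>r. c * (real ((r + R) choose R) / real ((k r + R) choose R))) \<longlonglongrightarrow> c * inverse (x ^ R)"
      using x by (intro tendsto_intros ratio k)
    show "(\<lambda>r. exp (- c) * (real ((r + R) choose R) / real ((m r + R) choose R)))
        \<longlonglongrightarrow> exp (- c) * inverse ((1 - x) ^ R)"
      using x(2) by (intro tendsto_intros ratio m) simp_all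
    show "0 \<le> exp (- c) * inverse ((1 - x) ^ R)" using x(2) by simp
    show "exp (- c) * inverse ((1 - x) ^ R) < 1" using c(1) by (simp add: \<beta>)
  qed
  moreover have "c * inverse (x ^ R) / (1 - exp (- c) * inverse ((1 - x) ^ R)) = mu R"
  proof -
    have "1 - exp (- c) * inverse ((1 - x) ^ R) = c / (c + 1)"
      unfolding \<beta> using c(1) by (simp add: field_simps)
    moreover have "c * inverse (x ^ R) = c * (c + 1) ^ R / c ^ R"
      by (simp add: x_def power_divide)
    ultimately show ?thesis using c(1) by (simp add: mu_def flip: c_def)
  qed
  ultimately show ?thesis by simp
qed

theorem theorem1p2:
  fixes R :: nat
  assumes "R \<ge> 1"
  shows "\<exists>\<epsilon> :: nat \<Rightarrow> real. \<epsilon> \<in> o(\<lambda>_. 1) \<and>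
           (\<forall>r\<ge>1. turan_density (r + R) r \<le> (mu R + \<epsilon> r) * inverse (real ((r + R) choose R)))"
proof (intro exI conjI allI impI)
  \<comment> \<open>The truncation gives the inequality for every \<open>r\<close>. Since the
    asymptotic bound is only from above, the plain difference need not tend to 0.\<close>
  let ?\<epsilon> = "\<lambda>r. max 0 (scaled_density R r - mu R)"
  have "?\<epsilon> \<longlonglongrightarrow> 0"
  proof (rule tendstoI)
    fix \<delta> :: real assume "\<delta> > 0"
    then have "eventually (\<lambda>r. scaled_density R r \<le> mu R + \<delta> / 2) sequentially"
      using eventually_scaled_density_le[OF assms, of "\<delta> / 2"] by simp
    then show "eventually (\<lambda>r. dist (?\<epsilon> r) 0 < \<delta>) sequentially"
      by eventually_elim (use \<open>\<delta> > 0\<close> in \<open>auto simp: dist_real_def\<close>)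
  qed
  then show "?\<epsilon> \<in> o(\<lambda>_. 1)" by (intro smalloI_tendsto) auto
  fix r :: nat
  have "scaled_density R r \<le> mu R + ?\<epsilon> r" by simp
  then have "scaled_density R r * inverse (real ((r + R) choose R))
      \<le> (mu R + ?\<epsilon> r) * inverse (real ((r + R) choose R))"
    by (intro mult_right_mono) auto
  moreover have "real ((r + R) choose R) \<noteq> 0" by simp
  then have "scaled_density R r * inverse (real ((r + R) choose R)) = turan_density (r + R) r"
    by (simp add: scaled_density_def)
  ultimately show "turan_density (r + R) r \<le> (mu R + ?\<epsilon> r) * inverse (real ((r + R) choose R))"
    by simp
qed

end
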